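(* Let $3 \le r \le 7$. Every $K_r$-minor free graph $G$ with at least one edge has an edge $uv$ such that $\deg(u) \le 2r-5$ and $uv$ belongs to at most $r-3$ triangles of $G$.
   Context: All graphs are finite and simple. A minor of $G$ is a graph obtained from $G$ by a sequence of edge deletions, edge contractions and vertex deletions; $G$ is $H$-minor free if it has no minor isomorphic to $H$. An edge $uv$ belongs to a triangle $uvw$ whenever $w$ is a common neighbour of $u$ and $v$. *)

theory Defs
  imports Main
begin

definition simple_graph :: "'a set \<Rightarrow> 'a set set \<Rightarrow> bool" where
  "simple_graph V E \<longleftrightarrow> finite V \<and>
     (\<forall>e\<in>E. \<exists>u v. u \<noteq> v \<and> u \<in> V \<and> v \<in> V \<and> e = {u, v})"

inductive minor_step :: "'a set \<times> 'a set set \<Rightarrow> 'a set \<times> 'a set set \<Rightarrow> bool" where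
  del_edge: "e \<in> E \<Longrightarrow> minor_step (V, E) (V, E - {e})"
| del_vertex: "v \<in> V \<Longrightarrow> minor_step (V, E) (V - {v}, {e \<in> E. v \<notin> e})"
| contract: "{u, v} \<in> E \<Longrightarrow> u \<noteq> v \<Longrightarrow>
    minor_step (V, E) (V - {v}, {e \<in> E. v \<notin> e} \<union> {{u, w} | w. {v, w} \<in> E \<and> w \<noteq> u})"

definition is_minor :: "'a set \<times> 'a set set \<Rightarrow> 'a set \<times> 'a set set \<Rightarrow> bool" where
  "is_minor H G \<longleftrightarrow> minor_step\<^sup>*\<^sup>* G H"

definition is_complete_graph :: "nat \<Rightarrow> 'a set \<Rightarrow> 'a set set \<Rightarrow> bool" where
  "is_complete_graph r V E \<longleftrightarrow> finite V \<and> card V = r \<and>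
     E = {{u, v} | u v. u \<in> V \<and> v \<in> V \<and> u \<noteq> v}"

definition Kr_minor_free :: "nat \<Rightarrow> 'a set \<Rightarrow> 'a set set \<Rightarrow> bool" where
  "Kr_minor_free r V E \<longleftrightarrow> \<not> (\<exists>V' E'. is_minor (V', E') (V, E) \<and> is_complete_graph r V' E')"

definition degree :: "'a set set \<Rightarrow> 'a \<Rightarrow> nat" where
  "degree E u = card {v. {u, v} \<in> E}"

definition triangles_on :: "'a set set \<Rightarrow> 'a \<Rightarrow> 'a \<Rightarrow> nat" where
  "triangles_on E u v = card {w. {u, w} \<in> E \<and> {v, w} \<in> E}"

end

theory Submission
  imports Defs
begin

text \<open>
  By Mader's bound, a graph on \<open>n\<close> vertices without a \<open>K\<^sub>r\<close> minor has at most
  \<open>(r - 2) n - (r - 1) (r - 2) / 2\<close> edges, hence a vertex of degree at most \<open>2 r - 5\<close>.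
  Suppose every edge at such a vertex lies in at least \<open>r - 2\<close> triangles. Then the neighbourhood \<open>H\<close> of
  a low vertex \<open>u\<close> has at most \<open>2 r - 5\<close> vertices and minimum degree at least \<open>r - 2\<close>. Contracting a component of
  \<open>G - N[u]\<close> attached to \<open>S \<subseteq> H\<close> into a vertex of \<open>S\<close> adds a star over \<open>S\<close> to \<open>H\<close>,
  and a \<open>K\<^bsub>r-1\<^esub>\<close> minor in the result gives a \<open>K\<^sub>r\<close> minor of \<open>G\<close>. A local argument on \<open>H\<close>
  shows that without such a minor some vertex of \<open>H - S\<close> has a neighbour in another component.
  Now choose \<open>u\<close> and a component \<open>C\<close> of \<open>G - N[u]\<close> with \<open>|C|\<close> least. Mader's bound for \<open>G[C]\<close> and
  \<open>G[C \<union> S]\<close> yields a low vertex \<open>u'\<close> in \<open>C\<close>, and a component of \<open>G - N[u']\<close> avoiding \<open>u\<close> is a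
  proper subset of \<open>C\<close>, a contradiction. Mader's bound itself follows by the same argument
  applied to a minimal counterexample, in which every edge lies in at least \<open>r - 2\<close> triangles because it cannot be contracted.
\<close>

section \<open>Degree sums\<close>

definition sgraph :: "('a \<Rightarrow> 'a \<Rightarrow> bool) \<Rightarrow> bool" where
  "sgraph E \<longleftrightarrow> (\<forall>x y. E x y \<longrightarrow> E y x) \<and> (\<forall>x. \<not> E x x)"

definition nb :: "('a \<Rightarrow> 'a \<Rightarrow> bool) \<Rightarrow> 'a set \<Rightarrow> 'a \<Rightarrow> 'a set" where
  "nb E W x = {y \<in> W. E x y}"

text \<open>Twice the number of edges inside \<open>W\<close>.\<close>

definition arcs :: "('a \<Rightarrow> 'a \<Rightarrow> bool) \<Rightarrow> 'a set \<Rightarrow> nat" where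
  "arcs E W = (\<Sum>x\<in>W. card (nb E W x))"

text \<open>With \<open>S = Collect (E y)\<close> and \<open>y\<close> dropped from the vertex set
  this is the contraction of the edge \<open>vy\<close> into \<open>v\<close>; for other
  \<open>S\<close> it is what remains of a whole connected set contracted into
  \<open>v\<close>.\<close>

definition star :: "('a \<Rightarrow> 'a \<Rightarrow> bool) \<Rightarrow> 'a \<Rightarrow> 'a set \<Rightarrow> 'a \<Rightarrow> 'a \<Rightarrow> bool" where
  "star E v S a b \<longleftrightarrow> E a b \<or> a = v \<and> b \<in> S \<and> b \<noteq> v \<or> b = v \<and> a \<in> S \<and> a \<noteq> v"

lemma sgraph_sym: "sgraph E \<Longrightarrow> E x y \<longleftrightarrow> E y x"
  and sgraph_irrefl: "sgraph E \<Longrightarrow> \<not> E x x"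
  by (auto simp: sgraph_def)

lemma finite_nb [simp]: "finite W \<Longrightarrow> finite (nb E W x)"
  by (simp add: nb_def)

lemma sgraph_star: "sgraph E \<Longrightarrow> sgraph (star E v S)"
  by (auto simp: sgraph_def star_def)

lemma sum_card_nb_swap:
  assumes "sgraph E" "finite A" "finite B"
  shows "(\<Sum>a\<in>A. card (nb E B a)) = (\<Sum>b\<in>B. card (nb E A b))"
proof -
  have card_eq: "card (nb E X x) = (\<Sum>y\<in>X. if E x y then 1 else 0)" if "finite X" for X x
    using that by (simp add: nb_def sum.If_cases Int_def)
  have "(\<Sum>a\<in>A. card (nb E B a)) = (\<Sum>a\<in>A. \<Sum>b\<in>B. if E a b then 1 else 0)"
    using assms by (simp add: card_eq)
  also have "\<dots> = (\<Sum>b\<in>B. \<Sum>a\<in>A. if E a b then 1 else 0)"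
    by (rule sum.swap)
  also have "\<dots> = (\<Sum>b\<in>B. \<Sum>a\<in>A. if E b a then 1 else 0)"
    by (simp add: sgraph_sym[OF assms(1)] cong: if_cong)
  also have "\<dots> = (\<Sum>b\<in>B. card (nb E A b))"
    using assms by (simp add: card_eq)
  finally show ?thesis .
qed

lemma card_nb_Un:
  assumes "finite A" "finite B" "A \<inter> B = {}"
  shows "card (nb E (A \<union> B) x) = card (nb E A x) + card (nb E B x)"
proof -
  have "nb E (A \<union> B) x = nb E A x \<union> nb E B x" "nb E A x \<inter> nb E B x = {}"
    using assms by (auto simp: nb_def)
  then show ?thesis using assms by (simp add: card_Un_disjoint)
qed

lemma sum_card_nb_Un:
  assumes "finite A" "finite B" "A \<inter> B = {}"
  shows "(\<Sum>a\<in>A. card (nb E (A \<union> B) a)) = arcs E A + (\<Sum>a\<in>A. card (nb E B a))"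
  using assms by (simp add: card_nb_Un sum.distrib arcs_def)

lemma arcs_Un:
  assumes "sgraph E" "finite A" "finite B" "A \<inter> B = {}"
  shows "arcs E (A \<union> B) = arcs E A + arcs E B + 2 * (\<Sum>a\<in>A. card (nb E B a))"
proof -
  have "arcs E (A \<union> B) = (\<Sum>a\<in>A. card (nb E (A \<union> B) a)) + (\<Sum>b\<in>B. card (nb E (A \<union> B) b))"
    using assms unfolding arcs_def by (simp add: sum.union_disjoint)
  also have "(\<Sum>b\<in>B. card (nb E (A \<union> B) b)) = arcs E B + (\<Sum>b\<in>B. card (nb E A b))"
    using assms sum_card_nb_Un[of B A E] by (simp add: Un_commute Int_commute)
  also have "(\<Sum>b\<in>B. card (nb E A b)) = (\<Sum>a\<in>A. card (nb E B a))"
    using assms sum_card_nb_swap by metis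
  finally show ?thesis using assms by (simp add: sum_card_nb_Un)
qed

lemma arcs_remove:
  assumes "sgraph E" "finite W" "v \<in> W"
  shows "arcs E W = arcs E (W - {v}) + 2 * card (nb E W v)"
proof -
  have "arcs E ({v} \<union> (W - {v})) = arcs E {v} + arcs E (W - {v}) + 2 * card (nb E (W - {v}) v)"
    using assms by (subst arcs_Un) auto
  moreover have "{v} \<union> (W - {v}) = W" using assms by auto
  moreover have "nb E (W - {v}) v = nb E W v" "nb E {v} v = {}"
    using assms by (auto simp: nb_def sgraph_def)
  ultimately show ?thesis by (simp add: arcs_def)
qed

lemma arcs_ge:
  assumes "finite W" "\<And>x. x \<in> W \<Longrightarrow> d \<le> card (nb E W x)"
  shows "d * card W \<le> arcs E W"
  using sum_bounded_below[of W d "\<lambda>x. card (nb E W x)"] assms by (simp add: arcs_def mult.commute)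

lemma card_nb_le:
  assumes "sgraph E" "finite W" "x \<in> W"
  shows "card (nb E W x) \<le> card W - 1"
proof -
  have "nb E W x \<subseteq> W - {x}" using assms by (auto simp: nb_def sgraph_def)
  then have "card (nb E W x) \<le> card (W - {x})" using assms by (intro card_mono) auto
  then show ?thesis using assms by simp
qed

lemma arcs_le:
  assumes "sgraph E" "finite W"
  shows "arcs E W \<le> card W * (card W - 1)"
  using sum_bounded_above[of W "\<lambda>x. card (nb E W x)" "card W - 1"] card_nb_le[OF assms]
  by (simp add: arcs_def)

lemma arcs_star:
  assumes "sgraph E" "finite W" "v \<in> W"
  shows "arcs (star E v S) W = arcs E W + 2 * card {s \<in> S \<inter> W. s \<noteq> v \<and> \<not> E v s}"
proof -
  have "nb (star E v S) W v = nb E W v \<union> {s \<in> S \<inter> W. s \<noteq> v \<and> \<not> E v s}"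
    using assms by (auto simp: nb_def star_def)
  moreover have "nb E W v \<inter> {s \<in> S \<inter> W. s \<noteq> v \<and> \<not> E v s} = {}"
    by (auto simp: nb_def)
  ultimately have "card (nb (star E v S) W v)
      = card (nb E W v) + card {s \<in> S \<inter> W. s \<noteq> v \<and> \<not> E v s}"
    using assms by (simp add: card_Un_disjoint)
  moreover have "arcs (star E v S) (W - {v}) = arcs E (W - {v})"
    unfolding arcs_def by (rule sum.cong) (auto simp: nb_def star_def intro!: arg_cong[of _ _ card])
  ultimately show ?thesis
    using arcs_remove[OF assms] arcs_remove[OF sgraph_star[OF assms(1)] assms(2,3)] by simp
qed

text \<open>Contraction loses the edge \<open>xy\<close> and merges two edges into one at every
  common neighbour; \<open>arcs\<close> counts each edge twice.\<close>

lemma arcs_contract: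
  assumes E: "sgraph E" and "finite W" "x \<in> W" "y \<in> W" "E x y"
  shows "arcs (star E x (Collect (E y))) (W - {y}) + 2 + 2 * card (nb E W x \<inter> nb E W y) = arcs E W"
proof -
  have ne: "x \<noteq> y" using assms by (auto simp: sgraph_def)
  let ?N = "{s \<in> Collect (E y) \<inter> (W - {y}). s \<noteq> x \<and> \<not> E x s}"
  have "nb E W y = insert x (?N \<union> (nb E W x \<inter> nb E W y))"
    using assms by (auto simp: nb_def sgraph_def)
  moreover have "card (insert x (?N \<union> (nb E W x \<inter> nb E W y)))
      = Suc (card ?N + card (nb E W x \<inter> nb E W y))"
    using assms by (subst card_insert_disjoint, simp, simp add: nb_def sgraph_irrefl[OF E],
        subst card_Un_disjoint) (auto simp: nb_def)
  ultimately have "card (nb E W y) = Suc (card ?N + card (nb E W x \<inter> nb E W y))" by simp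
  then show ?thesis
    using arcs_star[of E "W - {y}" x "Collect (E y)"] arcs_remove[of E W y] assms ne by simp
qed

section \<open>Complete minors\<close>

text \<open>Deletions are absorbed by \<open>clique\<close>, which looks only at the pairs inside
  some subset \<open>A\<close>, so contractions are the only steps. Using relations instead of edge
  sets lets \<open>star\<close> express them directly.\<close>

inductive KM :: "nat \<Rightarrow> 'a set \<Rightarrow> ('a \<Rightarrow> 'a \<Rightarrow> bool) \<Rightarrow> bool" for s where
  clique: "A \<subseteq> W \<Longrightarrow> finite A \<Longrightarrow> card A = s \<Longrightarrow> (\<And>x y. x \<in> A \<Longrightarrow> y \<in> A \<Longrightarrow> x \<noteq> y \<Longrightarrow> E x y) \<Longrightarrow> KM s W E"
| contr: "x \<in> W \<Longrightarrow> y \<in> W \<Longrightarrow> x \<noteq> y \<Longrightarrow> E x y \<Longrightarrow> KM s (W - {y}) (star E x (Collect (E y))) \<Longrightarrow> KM s W E"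

lemma KM_mono:
  assumes "KM s W E" "W \<subseteq> W'" "\<And>a b. a \<in> W \<Longrightarrow> b \<in> W \<Longrightarrow> E a b \<Longrightarrow> E' a b"
  shows "KM s W' E'"
  using assms
proof (induction arbitrary: W' E' rule: KM.induct)
  case (clique A W E)
  then show ?case by (intro KM.clique[of A]) blast+
next
  case (contr x W y E)
  show ?case
  proof (rule KM.contr[of x _ y])
    show "KM s (W' - {y}) (star E' x (Collect (E' y)))"
    proof (rule contr.IH)
      fix a b assume "a \<in> W - {y}" "b \<in> W - {y}" "star E x (Collect (E y)) a b"
      then show "star E' x (Collect (E' y)) a b"
        using contr.prems(2) contr.hyps unfolding star_def by blast
    qed (use contr in auto)
  qed (use contr in auto)
qed

lemma KM_insert_dominating:
  assumes "KM s W E" "u \<notin> W" "\<And>w. w \<in> W \<Longrightarrow> E u w \<and> E w u"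
  shows "KM (Suc s) (insert u W) E"
  using assms
proof (induction rule: KM.induct)
  case (clique A W E)
  then have "u \<notin> A" by auto
  then show ?case
    by (intro KM.clique[of "insert u A"]) (use clique in auto)
next
  case (contr x W y E)
  have "KM (Suc s) (insert u (W - {y})) (star E x (Collect (E y)))"
    by (rule contr.IH) (use contr in \<open>auto simp: star_def\<close>)
  moreover have "insert u (W - {y}) = insert u W - {y}" using contr by auto
  ultimately have "KM (Suc s) (insert u W - {y}) (star E x (Collect (E y)))" by (simp only:)
  then show ?case by (rule KM.contr[of x _ y, rotated 4]) (use contr.hyps in auto)
qed

text \<open>\<open>C\<close> is contracted into \<open>v\<close> one vertex at a time. Some
  neighbour \<open>y\<close> of \<open>v\<close> lies in \<open>C\<close>; after merging it, paths
  survive under the map sending \<open>y\<close> to \<open>v\<close>, and \<open>v\<close> inherits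
  the neighbours of \<open>y\<close>.\<close>

lemma KM_absorb:
  assumes "finite C" "C \<inter> W = {}" "v \<in> W" "sgraph E"
    and "\<And>c. c \<in> C \<Longrightarrow> (\<lambda>a b. E a b \<and> a \<in> insert v C \<and> b \<in> insert v C)\<^sup>*\<^sup>* v c"
    and "KM s W (star E v {b. \<exists>c\<in>C. E c b})"
  shows "KM s (W \<union> C) E"
  using assms
proof (induction "card C" arbitrary: C E)
  case 0
  then show ?case using KM_mono[OF 0(7), of W E] by (auto simp: star_def)
next
  case (Suc n)
  let ?R = "\<lambda>a b. E a b \<and> a \<in> insert v C \<and> b \<in> insert v C"
  obtain c where "c \<in> C" using Suc(2) by (metis card.empty equals0I nat.distinct(1))
  then have "?R\<^sup>*\<^sup>* v c" "v \<noteq> c" using Suc.prems by auto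
  then obtain y where "?R v y" by (auto elim: converse_rtranclpE)
  then have y: "E v y" "y \<in> C" using Suc.prems(4) by (auto simp: sgraph_irrefl)
  define E' where "E' = star E v (Collect (E y))"
  have vy: "v \<noteq> y" using y Suc.prems by auto
  have "KM s (W \<union> (C - {y})) E'"
  proof (rule Suc.hyps(1))
    show "n = card (C - {y})" using Suc.hyps(2) y Suc.prems(1) by simp
    show "sgraph E'" unfolding E'_def using Suc.prems(4) by (rule sgraph_star)
    let ?R' = "\<lambda>a b. E' a b \<and> a \<in> insert v (C - {y}) \<and> b \<in> insert v (C - {y})"
    let ?f = "\<lambda>a. if a = y then v else a"
    show "?R'\<^sup>*\<^sup>* v c" if "c \<in> C - {y}" for c
    proof -
      have image_path: "?R'\<^sup>*\<^sup>* (?f v) (?f c)" if "?R\<^sup>*\<^sup>* v c" for c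
        using that
      proof (induction rule: rtranclp_induct)
        case (step a b)
        have "?f a = ?f b \<or> ?R' (?f a) (?f b)"
          using step(2) Suc.prems(4) unfolding E'_def star_def sgraph_def by auto
        then show ?case
        proof
          assume "?f a = ?f b"
          then show ?thesis using step(3) by (simp only:)
        next
          assume "?R' (?f a) (?f b)"
          with step(3) show ?thesis by (rule rtranclp.rtrancl_into_rtrancl)
        qed
      qed simp
      show ?thesis using image_path[OF Suc.prems(5)[of c]] that vy by simp
    qed
    show "KM s W (star E' v {b. \<exists>c\<in>C - {y}. E' c b})"
    proof (rule KM_mono[OF Suc.prems(6)])
      fix a b assume "star E v {b. \<exists>c\<in>C. E c b} a b"
      then show "star E' v {b. \<exists>c\<in>C - {y}. E' c b} a b"
        unfolding E'_def star_def by auto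
    qed simp
  qed (use Suc.prems in auto)
  moreover have "W \<union> (C - {y}) = (W \<union> C) - {y}" using y Suc.prems by auto
  ultimately have "KM s ((W \<union> C) - {y}) (star E v (Collect (E y)))"
    unfolding E'_def by (simp only:)
  moreover have "v \<in> W \<union> C" "y \<in> W \<union> C" using y Suc.prems(3) by auto
  ultimately show ?case using KM.contr[of v "W \<union> C" y E s] y(1) vy by blast
qed

section \<open>From \<open>KM\<close> to minors in the sense of \<open>is_minor\<close>\<close>

lemma minor_delete_vertices:
  assumes "finite D" "D \<subseteq> W" "simple_graph W F"
  shows "\<exists>F'. is_minor (W - D, F') (W, F) \<and> simple_graph (W - D) F' \<and>
    (\<forall>a\<in>W - D. \<forall>b\<in>W - D. {a, b} \<in> F \<longrightarrow> {a, b} \<in> F')"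
  using assms
proof (induction D rule: finite_induct)
  case empty
  then show ?case by (auto simp: is_minor_def)
next
  case (insert x D)
  then obtain F' where F': "is_minor (W - D, F') (W, F)" "simple_graph (W - D) F'"
    "\<forall>a\<in>W - D. \<forall>b\<in>W - D. {a, b} \<in> F \<longrightarrow> {a, b} \<in> F'"
    by auto
  have "minor_step (W - D, F') (W - D - {x}, {e \<in> F'. x \<notin> e})"
    using insert by (intro minor_step.del_vertex) auto
  then have "is_minor (W - insert x D, {e \<in> F'. x \<notin> e}) (W, F)"
    using F'(1) unfolding is_minor_def
    by (metis (no_types, lifting) Diff_insert rtranclp.rtrancl_into_rtrancl)
  moreover have "simple_graph (W - insert x D) {e \<in> F'. x \<notin> e}"
    using F'(2) unfolding simple_graph_def by fastforce
  ultimately show ?case using F'(3) by (intro exI[of _ "{e \<in> F'. x \<notin> e}"]) auto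
qed

text \<open>\<open>F\<close> only has to contain the pairs of \<open>E\<close>, an invariant that
  contraction preserves. At the end the vertices off the clique are deleted, and a simple graph on
  \<open>A\<close> containing all pairs is complete.\<close>

lemma KM_imp_minor:
  assumes "KM s W E" "simple_graph W F"
    and "\<And>a b. a \<in> W \<Longrightarrow> b \<in> W \<Longrightarrow> a \<noteq> b \<Longrightarrow> E a b \<Longrightarrow> {a, b} \<in> F"
  shows "\<exists>V' E'. is_minor (V', E') (W, F) \<and> is_complete_graph s V' E'"
  using assms
proof (induction arbitrary: F rule: KM.induct)
  case (clique A W E)
  have "finite (W - A)" using clique.prems(1) by (auto simp: simple_graph_def)
  then obtain F' where F': "is_minor (W - (W - A), F') (W, F)" "simple_graph (W - (W - A)) F'"
    "\<forall>a\<in>W - (W - A). \<forall>b\<in>W - (W - A). {a, b} \<in> F \<longrightarrow> {a, b} \<in> F'"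
    using minor_delete_vertices[of "W - A" W F] clique.prems by blast
  have eq: "W - (W - A) = A" using clique by auto
  have "is_complete_graph s A F'"
    unfolding is_complete_graph_def
  proof (intro conjI)
    show "F' = {{u, v} |u v. u \<in> A \<and> v \<in> A \<and> u \<noteq> v}"
    proof
      show "F' \<subseteq> {{u, v} |u v. u \<in> A \<and> v \<in> A \<and> u \<noteq> v}"
        using F'(2) unfolding eq simple_graph_def by blast
      show "{{u, v} |u v. u \<in> A \<and> v \<in> A \<and> u \<noteq> v} \<subseteq> F'"
        using F'(3) clique unfolding eq by blast
    qed
  qed (use clique in auto)
  then show ?case using F'(1) eq by metis
next
  case (contr x W y E)
  define F' where "F' = {e \<in> F. y \<notin> e} \<union> {{x, w} | w. {y, w} \<in> F \<and> w \<noteq> x}"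
  have xy: "{x, y} \<in> F" using contr by blast
  have step: "minor_step (W, F) (W - {y}, F')"
    unfolding F'_def using xy contr.hyps(3) by (rule minor_step.contract)
  have memW: "w \<in> W \<and> w \<noteq> y" if "{y, w} \<in> F" for w
    using contr.prems(1) that unfolding simple_graph_def by (metis doubleton_eq_iff)
  have "simple_graph (W - {y}) F'"
    unfolding simple_graph_def
  proof (intro conjI ballI)
    show "finite (W - {y})" using contr.prems(1) by (simp add: simple_graph_def)
    fix e assume "e \<in> F'"
    then consider "e \<in> F" "y \<notin> e" | w where "e = {x, w}" "{y, w} \<in> F" "w \<noteq> x"
      unfolding F'_def by blast
    then show "\<exists>u v. u \<noteq> v \<and> u \<in> W - {y} \<and> v \<in> W - {y} \<and> e = {u, v}"
    proof cases
      case 1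
      then obtain u v where "u \<noteq> v" "u \<in> W" "v \<in> W" "e = {u, v}"
        using contr.prems(1) unfolding simple_graph_def by blast
      then show ?thesis using 1 by blast
    next
      case 2
      then show ?thesis using memW[of w] contr.hyps by blast
    qed
  qed
  moreover have "{a, b} \<in> F'"
    if "a \<in> W - {y}" "b \<in> W - {y}" "a \<noteq> b" "star E x (Collect (E y)) a b" for a b
  proof -
    consider "E a b" | "a = x" "E y b" "b \<noteq> x" | "b = x" "E y a" "a \<noteq> x"
      using \<open>star E x (Collect (E y)) a b\<close> unfolding star_def by auto
    then show ?thesis
    proof cases
      case 1
      then show ?thesis using that contr.prems(2) unfolding F'_def by blast
    next
      case 2
      then have "{y, b} \<in> F" using that contr by blast
      then show ?thesis using 2 unfolding F'_def by blast
    next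
      case 3
      then have "{y, a} \<in> F" using that contr by blast
      then show ?thesis using 3 unfolding F'_def by (auto simp: insert_commute)
    qed
  qed
  ultimately obtain V' E' where "is_minor (V', E') (W - {y}, F')" "is_complete_graph s V' E'"
    using contr.IH by blast
  then show ?case using step unfolding is_minor_def by (meson converse_rtranclp_into_rtranclp)
qed

section \<open>Components\<close>

definition comp :: "('a \<Rightarrow> 'a \<Rightarrow> bool) \<Rightarrow> 'a set \<Rightarrow> 'a \<Rightarrow> 'a set" where
  "comp E X x = {y. (\<lambda>a b. E a b \<and> a \<in> X \<and> b \<in> X)\<^sup>*\<^sup>* x y}"

lemma comp_self: "x \<in> comp E X x"
  by (simp add: comp_def)

lemma comp_least:
  assumes "x \<in> Y" "\<And>a b. a \<in> Y \<Longrightarrow> b \<in> X \<Longrightarrow> E a b \<Longrightarrow> b \<in> Y"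
  shows "comp E X x \<subseteq> Y"
proof
  fix y assume "y \<in> comp E X x"
  then have "(\<lambda>a b. E a b \<and> a \<in> X \<and> b \<in> X)\<^sup>*\<^sup>* x y" by (simp add: comp_def)
  then show "y \<in> Y" by (induction rule: rtranclp_induct) (use assms in auto)
qed

lemma comp_subset: "x \<in> X \<Longrightarrow> comp E X x \<subseteq> X"
  by (rule comp_least)

lemma comp_closed:
  assumes "x \<in> X" "a \<in> comp E X x" "E a b" "b \<in> X"
  shows "b \<in> comp E X x"
proof -
  have "a \<in> X" using assms comp_subset by fastforce
  then show ?thesis using assms unfolding comp_def
    by (simp add: rtranclp.rtrancl_into_rtrancl)
qed

lemma comp_connected:
  assumes "sgraph E" "x \<in> X" "a \<in> comp E X x" "b \<in> comp E X x"
  shows "(\<lambda>p q. E p q \<and> p \<in> comp E X x \<and> q \<in> comp E X x)\<^sup>*\<^sup>* a b"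
proof -
  let ?R = "\<lambda>p q. E p q \<and> p \<in> comp E X x \<and> q \<in> comp E X x"
  have reach: "?R\<^sup>*\<^sup>* x y" if "y \<in> comp E X x" for y
  proof -
    have "y \<in> comp E X x \<and> ?R\<^sup>*\<^sup>* x y" if "(\<lambda>a b. E a b \<and> a \<in> X \<and> b \<in> X)\<^sup>*\<^sup>* x y" for y
      using that
    proof (induction rule: rtranclp_induct)
      case base
      then show ?case by (simp add: comp_self)
    next
      case (step p q)
      then have "q \<in> comp E X x" using comp_closed[OF assms(2)] by blast
      then have "?R p q" using step by blast
      then show ?case using step rtranclp.rtrancl_into_rtrancl[of ?R x p q] by blast
    qed
    then show ?thesis using that by (simp add: comp_def)
  qed
  have "symp ?R" using assms(1) by (auto simp: symp_def sgraph_def)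
  then have "?R\<^sup>*\<^sup>* a x" using reach[OF assms(3)] by (metis (no_types, lifting) symp_rtranclp sympD)
  then show ?thesis using reach[OF assms(4)] by (rule rtranclp_trans)
qed

text \<open>The vertex \<open>u\<close> dominates its neighbourhood and so enlarges the minor by
  one; contracting the component into \<open>v\<close> supplies the star edges.\<close>

lemma KM_star_component:
  fixes E :: "'a \<Rightarrow> 'a \<Rightarrow> bool"
  defines "far \<equiv> \<lambda>V u. V - insert u (nb E V u)"
  assumes "finite V" "sgraph E" "u \<in> V" "x \<in> far V u" "v \<in> nb E V u"
    and "c \<in> comp E (far V u) x" "E c v"
    and "KM s (nb E V u) (star E v {y \<in> nb E V u. \<exists>c\<in>comp E (far V u) x. E c y})"
  shows "KM (Suc s) V E"
proof -
  define C where "C = comp E (far V u) x"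
  have C: "C \<subseteq> far V u" unfolding C_def using assms(5) by (rule comp_subset)
  have "KM (Suc s) (insert u (nb E V u)) (star E v {y \<in> nb E V u. \<exists>c\<in>C. E c y})"
    by (rule KM_insert_dominating)
      (use assms in \<open>auto simp: nb_def star_def C_def sgraph_def\<close>)
  then have star: "KM (Suc s) (insert u (nb E V u)) (star E v {y. \<exists>c\<in>C. E c y})"
    by (rule KM_mono) (auto simp: star_def)
  have "KM (Suc s) (insert u (nb E V u) \<union> C) E"
  proof (rule KM_absorb[OF _ _ _ assms(3) _ star])
    show "finite C" using C assms(2) unfolding far_def by (meson finite_Diff finite_subset)
    show "C \<inter> insert u (nb E V u) = {}" using C unfolding far_def by auto
    show "v \<in> insert u (nb E V u)" using assms by simp
    let ?R = "\<lambda>a b. E a b \<and> a \<in> insert v C \<and> b \<in> insert v C"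
    fix d assume "d \<in> C"
    then have "(\<lambda>a b. E a b \<and> a \<in> C \<and> b \<in> C)\<^sup>*\<^sup>* c d"
      using comp_connected[OF assms(3,5)] assms(7) unfolding C_def by blast
    then have "?R\<^sup>*\<^sup>* c d" by (rule rtranclp_mono[THEN predicate2D, rotated]) auto
    moreover have "?R v c" using assms(3,7,8) unfolding C_def sgraph_def by auto
    ultimately show "?R\<^sup>*\<^sup>* v d" by (rule converse_rtranclp_into_rtranclp[rotated])
  qed
  then show ?thesis
    by (rule KM_mono) (use C assms(4) in \<open>auto simp: far_def nb_def\<close>)
qed

section \<open>From neighbourhoods to the whole graph\<close>

text \<open>\<open>H\<close> models the neighbourhood of a low vertex \<open>u\<close>, and
  \<open>H - S\<close> consists of vertices with no neighbour outside the closed neighbourhood of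
  \<open>u\<close>. One of the \<open>r - 2\<close> triangles on \<open>zw\<close> goes through
  \<open>u\<close>, so \<open>r - 3\<close> common neighbours remain in \<open>H\<close>.\<close>

definition local_config :: "nat \<Rightarrow> 'a set \<Rightarrow> ('a \<Rightarrow> 'a \<Rightarrow> bool) \<Rightarrow> 'a set \<Rightarrow> bool" where
  "local_config r H E S \<longleftrightarrow> finite H \<and> H \<noteq> {} \<and> sgraph E \<and> card H \<le> 2 * r - 5 \<and> S \<subseteq> H \<and>
     (\<forall>x\<in>H. r - 2 \<le> card (nb E H x)) \<and>
     (\<forall>z\<in>H - S. \<forall>w\<in>H. E z w \<longrightarrow> r - 3 \<le> card (nb E H z \<inter> nb E H w))"

definition star_minor :: "nat \<Rightarrow> 'a set \<Rightarrow> ('a \<Rightarrow> 'a \<Rightarrow> bool) \<Rightarrow> 'a set \<Rightarrow> bool" where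
  "star_minor s H E S \<longleftrightarrow> KM s H E \<or> (\<exists>v\<in>S. KM s H (star E v S))"

text \<open>The contradiction for a component \<open>C\<close> without low vertices, where \<open>m = |C|\<close>, \<open>k = |S|\<close>, \<open>aC\<close> and \<open>aS\<close> are
  the degree sums inside \<open>C\<close> and \<open>S\<close>, and \<open>x\<close> counts the edges between \<open>C\<close> and \<open>S\<close>.\<close>

lemma component_count:
  fixes r m k aC aS x :: nat
  assumes "3 \<le> r" "r \<le> 7" "k \<le> 2 * r - 5"
    and deg: "(2 * r - 4) * m \<le> aC + x"
    and "aC + aS + 2 * x + (r - 1) * (r - 2) \<le> 2 * (r - 2) * (m + k)"
    and "k * k \<le> aS + (r - 3) * k"
    and "r - 2 \<le> m \<Longrightarrow> aC + (r - 1) * (r - 2) \<le> 2 * (r - 2) * m"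
    and "aC \<le> m * (m - 1)" "2 * r - 3 \<le> k + m"
  shows False
proof -
  have *: "(2 * r - 4) * m = 2 * (r - 2) * m" by (simp add: diff_mult_distrib2)
  \<comment> \<open>Doubling \<open>deg\<close> and cancelling \<open>2 * x\<close> against the
    bound for the union eliminates \<open>x\<close>.\<close>
  have sum: "aS + 2 * (r - 2) * m + (r - 1) * (r - 2) \<le> 2 * (r - 2) * k + aC"
    using assms(4,5) unfolding * by (simp add: distrib_left)
  \<comment> \<open>Finitely many values of \<open>k\<close>, and of \<open>m\<close> below
    \<open>r - 2\<close>, remain for each \<open>r\<close>. For \<open>r - 2 \<le> m\<close> the
    bound on \<open>aC\<close> turns \<open>sum\<close> into k^2 + 2(r-1)(r-2) \<le> (3r-7)k, whose
    discriminant r^2 - 18r + 33 is negative; for smaller \<open>m\<close> the bound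
    \<open>m * (m - 1)\<close> replaces Mader's.\<close>
  consider "r = 3" | "r = 4" | "r = 5" | "r = 6" | "r = 7" using assms(1,2) by linarith
  then show False
  proof cases
    case 1
    then have k: "k = 0 \<or> k = 1"
      using assms(3) by presburger
    show False
    proof (cases "r - 2 \<le> m")
      case True
      have "aS + 2 * (r - 1) * (r - 2) \<le> 2 * (r - 2) * k"
        using sum assms(7)[OF True] by simp
      then show False using k assms(6) 1 by (elim disjE) simp_all
    next
      case False
      then have m: "m = 0" using 1 by presburger
      show False using k m sum assms(6,8,9) 1 by (elim disjE) simp_all
    qed
  next
    case 2
    then have k: "k = 0 \<or> k = 1 \<or> k = 2 \<or> k = 3"
      using assms(3) by presburger
    show False
    proof (cases "r - 2 \<le> m")
      case True
      have "aS + 2 * (r - 1) * (r - 2) \<le> 2 * (r - 2) * k"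
        using sum assms(7)[OF True] by simp
      then show False using k assms(6) 2 by (elim disjE) simp_all
    next
      case False
      then have m: "m = 0 \<or> m = 1" using 2 by presburger
      show False using k m sum assms(6,8,9) 2 by (elim disjE) simp_all
    qed
  next
    case 3
    then have k: "k = 0 \<or> k = 1 \<or> k = 2 \<or> k = 3 \<or> k = 4 \<or> k = 5"
      using assms(3) by presburger
    show False
    proof (cases "r - 2 \<le> m")
      case True
      have "aS + 2 * (r - 1) * (r - 2) \<le> 2 * (r - 2) * k"
        using sum assms(7)[OF True] by simp
      then show False using k assms(6) 3 by (elim disjE) simp_all
    next
      case False
      then have m: "m = 0 \<or> m = 1 \<or> m = 2" using 3 by presburger
      show False using k m sum assms(6,8,9) 3 by (elim disjE) simp_all
    qed
  next
    case 4
    then have k: "k = 0 \<or> k = 1 \<or> k = 2 \<or> k = 3 \<or> k = 4 \<or> k = 5 \<or> k = 6 \<or> k = 7"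
      using assms(3) by presburger
    show False
    proof (cases "r - 2 \<le> m")
      case True
      have "aS + 2 * (r - 1) * (r - 2) \<le> 2 * (r - 2) * k"
        using sum assms(7)[OF True] by simp
      then show False using k assms(6) 4 by (elim disjE) simp_all
    next
      case False
      then have m: "m = 0 \<or> m = 1 \<or> m = 2 \<or> m = 3" using 4 by presburger
      show False using k m sum assms(6,8,9) 4 by (elim disjE) simp_all
    qed
  next
    case 5
    then have k: "k = 0 \<or> k = 1 \<or> k = 2 \<or> k = 3 \<or> k = 4 \<or> k = 5 \<or> k = 6 \<or> k = 7 \<or> k = 8 \<or> k = 9"
      using assms(3) by presburger
    show False
    proof (cases "r - 2 \<le> m")
      case True
      have "aS + 2 * (r - 1) * (r - 2) \<le> 2 * (r - 2) * k"
        using sum assms(7)[OF True] by simp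
      then show False using k assms(6) 5 by (elim disjE) simp_all
    next
      case False
      then have m: "m = 0 \<or> m = 1 \<or> m = 2 \<or> m = 3 \<or> m = 4" using 5 by presburger
      show False using k m sum assms(6,8,9) 5 by (elim disjE) simp_all
    qed
  qed
qed

text \<open>The common frame of two counterexamples: a minimal one to Mader's bound and one to the
  theorem. Sparsity is assumed for proper subsets only, so that the former qualifies.\<close>

locale locally_dense =
  fixes V :: "'a set" and E :: "'a \<Rightarrow> 'a \<Rightarrow> bool" and r :: nat
  assumes r: "3 \<le> r" "r \<le> 7"
    and fin: "finite V" and sg: "sgraph E"
    and loc: "\<And>(H :: 'a set) F S. local_config r H F S \<Longrightarrow> star_minor (r - 1) H F S"
    and sparse: "\<And>X. X \<subset> V \<Longrightarrow> r - 2 \<le> card X \<Longrightarrow> arcs E X + (r - 1) * (r - 2) \<le> 2 * (r - 2) * card X"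
    and tri: "\<And>u v. u \<in> V \<Longrightarrow> v \<in> V \<Longrightarrow> E u v \<Longrightarrow> card (nb E V u) \<le> 2 * r - 5 \<Longrightarrow>
      r - 2 \<le> card (nb E V u \<inter> nb E V v)"
    and pos: "\<And>u. u \<in> V \<Longrightarrow> nb E V u \<noteq> {}"
    and free: "\<not> KM r V E"
begin

definition low :: "'a \<Rightarrow> bool" where
  "low u \<longleftrightarrow> u \<in> V \<and> card (nb E V u) \<le> 2 * r - 5"

definition far :: "'a \<Rightarrow> 'a set" where
  "far u = V - insert u (nb E V u)"

lemma nb_nb: "w \<in> V \<Longrightarrow> nb E (nb E V u) w = nb E V u \<inter> nb E V w"
  by (auto simp: nb_def)

lemma low_neighbourhood_degree:
  assumes "low u" "v \<in> nb E V u"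
  shows "r - 2 \<le> card (nb E (nb E V u) v)"
  using assms tri[of u v] nb_nb[of v u] by (auto simp: low_def nb_def)

text \<open>Otherwise each \<open>z\<close> in \<open>H - S\<close> has all its neighbours in the
  closed neighbourhood of \<open>u\<close>. Then \<open>z\<close> is itself low, \<open>tri\<close>
  applies to its edges, and \<open>H\<close> with \<open>S\<close> is a local configuration.\<close>

lemma outside_neighbour:
  assumes "low u" "S \<subseteq> nb E V u" "\<not> star_minor (r - 1) (nb E V u) E S"
  shows "\<exists>z\<in>nb E V u - S. \<exists>y\<in>far u. E z y"
proof (rule ccontr)
  assume closed: "\<not> ?thesis"
  let ?H = "nb E V u"
  have u: "u \<in> V" "card ?H \<le> 2 * r - 5" using assms(1) by (auto simp: low_def)
  have "r - 3 \<le> card (nb E ?H z \<inter> nb E ?H w)" if "z \<in> ?H - S" "w \<in> ?H" "E z w" for z w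
  proof -
    have z: "z \<in> V" "w \<in> V" "E u z" "E u w" using that by (auto simp: nb_def)
    have "y \<notin> far u" if "E z y" for y using closed \<open>z \<in> ?H - S\<close> that by blast
    then have sub: "nb E V z \<subseteq> insert u (?H - {z})"
      using sgraph_irrefl[OF sg] by (auto simp: nb_def[of E V z] far_def)
    have "card (nb E V z) \<le> card (insert u (?H - {z}))"
      using sub fin by (intro card_mono) auto
    also have "\<dots> = card ?H"
      using that(1) fin sg card_Suc_Diff1[of ?H z] by (simp add: nb_def sgraph_def)
    finally have "r - 2 \<le> card (nb E V z \<inter> nb E V w)" using tri[of z w] z that u by simp
    also have "nb E V z \<inter> nb E V w = insert u (nb E ?H z \<inter> nb E ?H w)"
      using sub z u sg by (auto simp: nb_def sgraph_def)
    also have "card \<dots> \<le> Suc (card (nb E ?H z \<inter> nb E ?H w))"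
      using fin by (simp add: card_insert_if)
    finally show ?thesis by simp
  qed
  then have "local_config r ?H E S"
    unfolding local_config_def
    using fin sg pos u assms(1,2) low_neighbourhood_degree by auto
  then show False using loc assms(3) by blast
qed

definition attached :: "'a \<Rightarrow> 'a \<Rightarrow> 'a set" where
  "attached u x = {y \<in> nb E V u. \<exists>c\<in>comp E (far u) x. E c y}"

lemma no_star_minor:
  assumes "u \<in> V" "x \<in> far u"
  shows "\<not> star_minor (r - 1) (nb E V u) E (attached u x)"
proof
  assume "star_minor (r - 1) (nb E V u) E (attached u x)"
  then consider "KM (r - 1) (nb E V u) E"
    | v where "v \<in> attached u x" "KM (r - 1) (nb E V u) (star E v (attached u x))"
    unfolding star_minor_def by blast
  then have "KM (Suc (r - 1)) V E"
  proof cases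
    case 1
    have "KM (Suc (r - 1)) (insert u (nb E V u)) E"
      by (rule KM_insert_dominating[OF 1]) (use sg in \<open>auto simp: nb_def sgraph_def\<close>)
    then show ?thesis by (rule KM_mono) (use assms in \<open>auto simp: nb_def\<close>)
  next
    case 2
    then show ?thesis
      using KM_star_component[OF fin sg assms(1), of x v] assms(2)
      unfolding attached_def far_def by blast
  qed
  then show False using free r by simp
qed

lemma low_vertex_in_component:
  assumes "low u" "x \<in> far u"
  shows "\<exists>u'\<in>comp E (far u) x. low u'"
proof (rule ccontr)
  assume none: "\<not> ?thesis"
  define C where "C = comp E (far u) x"
  define S where "S = attached u x"
  define H where "H = nb E V u"
  define e where "e = (\<Sum>c\<in>C. card (nb E S c))"
  have u: "u \<in> V" and cardH: "card H \<le> 2 * r - 5" using assms(1) by (auto simp: low_def H_def)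
  have C: "C \<subseteq> far u" unfolding C_def using assms(2) by (rule comp_subset)
  have S: "S \<subseteq> H" unfolding S_def H_def attached_def by auto
  have sub: "C \<subseteq> V - {u}" "S \<subseteq> V - {u}" "C \<inter> S = {}"
    using C S sg unfolding far_def H_def by (auto simp: nb_def sgraph_def)
  have finCS: "finite C" "finite S" "finite H"
    using sub fin H_def by (auto intro: finite_subset)
  have nbC: "nb E V c = nb E (C \<union> S) c" if "c \<in> C" for c
  proof -
    have "y \<in> C \<union> S" if "y \<in> V" "E c y" for y
    proof (cases "y \<in> far u")
      case True
      then show ?thesis using comp_closed[OF assms(2)] \<open>c \<in> C\<close> that unfolding C_def by blast
    next
      case False
      moreover have "y \<noteq> u" using \<open>c \<in> C\<close> C that sg by (auto simp: far_def nb_def sgraph_def)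
      ultimately have "y \<in> nb E V u" using that by (auto simp: far_def)
      then show ?thesis using \<open>c \<in> C\<close> that unfolding S_def attached_def C_def by blast
    qed
    then show ?thesis using sub by (auto simp: nb_def)
  qed
  have high: "2 * r - 4 \<le> card (nb E (C \<union> S) c)" if "c \<in> C" for c
    using none nbC[OF that] that sub unfolding low_def C_def by fastforce
  have xC: "x \<in> C" unfolding C_def by (rule comp_self)
  have "card (nb E (C \<union> S) x) \<le> card (C \<union> S - {x})"
    using finCS sg by (intro card_mono) (auto simp: nb_def sgraph_def)
  moreover have "card (C \<union> S - {x}) = card C + card S - 1"
    using finCS sub xC by (simp add: card_Un_disjoint)
  moreover have "0 < card C" using xC finCS by (auto simp: card_gt_0_iff)
  \<comment> \<open>The at least \<open>2 * r - 4\<close> neighbours of \<open>x\<close> lie in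
    \<open>C \<union> S\<close> and differ from \<open>x\<close>.\<close>
  ultimately have big: "2 * r - 3 \<le> card S + card C" using high[OF xC] r by linarith
  have sum: "(2 * r - 4) * card C \<le> arcs E C + e"
    using sum_bounded_below[of C "2 * r - 4" "\<lambda>c. card (nb E (C \<union> S) c)"] high
      sum_card_nb_Un[OF finCS(1,2) sub(3), of E]
    by (simp add: e_def mult.commute)
  have "u \<notin> C \<union> S" using sub by auto
  \<comment> \<open>Both sets miss \<open>u\<close>, which makes \<open>sparse\<close> available for
    them.\<close>
  then have psub: "C \<subset> V" "C \<union> S \<subset> V" using sub u by auto
  have cardCS: "card (C \<union> S) = card C + card S" using finCS sub by (simp add: card_Un_disjoint)
  have "arcs E (C \<union> S) + (r - 1) * (r - 2) \<le> 2 * (r - 2) * (card C + card S)"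
    using sparse[OF psub(2)] big cardCS r by simp
  then have total: "arcs E C + arcs E S + 2 * e + (r - 1) * (r - 2) \<le> 2 * (r - 2) * (card C + card S)"
    using arcs_Un[OF sg finCS(1,2) sub(3)] by (simp add: e_def)
  \<comment> \<open>Of the at least \<open>r - 2\<close> neighbours of \<open>s\<close> in
    \<open>H\<close>, at most \<open>2 * r - 5 - card S\<close> lie outside
    \<open>S\<close>.\<close>
  have degS: "card S \<le> card (nb E S s) + (r - 3)" if "s \<in> S" for s
  proof -
    have "r - 2 \<le> card (nb E H s)"
      using low_neighbourhood_degree[OF assms(1)] that S unfolding H_def by blast
    also have "nb E H s = nb E (S \<union> (H - S)) s" using S by (simp add: Un_absorb1)
    also have "card \<dots> = card (nb E S s) + card (nb E (H - S) s)"
      using finCS by (intro card_nb_Un) auto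
    also have "card (nb E (H - S) s) \<le> card (H - S)"
      using finCS by (intro card_mono) (auto simp: nb_def)
    also have "card (H - S) = card H - card S" using finCS S by (simp add: card_Diff_subset)
    finally show ?thesis using cardH r card_mono[OF finCS(3) S] by linarith
  qed
  have "(\<Sum>s\<in>S. card S) \<le> (\<Sum>s\<in>S. card (nb E S s) + (r - 3))" by (rule sum_mono) (rule degS)
  then have inner: "card S * card S \<le> arcs E S + (r - 3) * card S"
    by (simp add: sum.distrib arcs_def mult.commute)
  have "card S \<le> 2 * r - 5" using card_mono[OF finCS(3) S] cardH by linarith
  then show False
    using component_count[OF r _ sum total inner sparse[OF psub(1)] arcs_le[OF sg finCS(1)] big]
    by blast
qed

theorem no_low_vertex: "\<not> low u"
proof
  assume "low u"
  define size_at where "size_at = (\<lambda>(u, x). card (comp E (far u) x))"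
  define ok where "ok = (\<lambda>(u, x). low u \<and> x \<in> far u)"
  have "\<not> star_minor (r - 1) (nb E V u) E {}"
  proof
    assume "star_minor (r - 1) (nb E V u) E {}"
    then have "KM (r - 1) (nb E V u) E" by (simp add: star_minor_def)
    then have "KM (Suc (r - 1)) (insert u (nb E V u)) E"
      by (rule KM_insert_dominating) (use sg in \<open>auto simp: nb_def sgraph_def\<close>)
    then have "KM (Suc (r - 1)) V E"
      by (rule KM_mono) (use \<open>low u\<close> in \<open>auto simp: nb_def low_def\<close>)
    then show False using free r by simp
  qed
  \<comment> \<open>With \<open>S = {}\<close> the outside neighbour shows that \<open>far u\<close>
    is nonempty.\<close>
  then obtain x where "x \<in> far u" using outside_neighbour[OF \<open>low u\<close>, of "{}"] by blast
  then have "ok (u, x)" using \<open>low u\<close> by (simp add: ok_def)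
  then obtain p where p: "ok p" "\<And>q. ok q \<Longrightarrow> size_at p \<le> size_at q"
    using ex_has_least_nat[of ok "(u, x)" size_at] by blast
  obtain u x where [simp]: "p = (u, x)" by (cases p)
  have u: "low u" "x \<in> far u" using p(1) by (auto simp: ok_def)
  define C where "C = comp E (far u) x"
  have C: "C \<subseteq> far u" unfolding C_def using u(2) by (rule comp_subset)
  obtain u' where u': "u' \<in> C" "low u'" using low_vertex_in_component[OF u] C_def by blast
  have u'V: "u' \<in> V" "u' \<noteq> u" "\<not> E u u'" using u' C unfolding low_def far_def nb_def by auto
  have uV: "u \<in> V" using u by (simp add: low_def)
  then have ufar: "u \<in> far u'" using u'V sg by (auto simp: far_def nb_def sgraph_def)
  \<comment> \<open>Here \<open>S\<close> is the attachment of the component of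
    \<open>far u'\<close> that contains the old vertex \<open>u\<close>.\<close>
  obtain z y where zy: "z \<in> nb E V u'" "z \<notin> attached u' u" "y \<in> far u'" "E z y"
    using outside_neighbour[OF u'(2) _ no_star_minor[OF u'V(1) ufar]] unfolding attached_def by blast
  define D where "D = comp E (far u') u"
  have uD: "u \<in> D" unfolding D_def by (rule comp_self)
  have zD: "\<not> E c z" if "c \<in> D" for c
    using zy(1,2) that unfolding attached_def D_def by blast
  have D_closed: "b \<in> D" if "a \<in> D" "E a b" "b \<in> far u'" for a b
    using comp_closed[OF ufar] that unfolding D_def by blast
  have yD: "y \<notin> D" using zD[of y] zy(4) sg by (auto simp: sgraph_def)
  have yV: "y \<in> V" "z \<in> V" using zy by (auto simp: far_def nb_def)
  have C_closed: "b \<in> C" if "a \<in> C" "E a b" "b \<in> V" "\<not> E u b" "b \<noteq> u" for a b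
    using comp_closed[OF u(2), of a E b] that unfolding C_def far_def nb_def by blast
  \<comment> \<open>\<open>z\<close> is adjacent to \<open>u'\<close> in \<open>C\<close>, and it is
    neither \<open>u\<close> nor a neighbour of \<open>u\<close>, since it sees nothing in
    \<open>D\<close>. The same closure argument then carries \<open>y\<close> into
    \<open>C\<close>.\<close>
  have zC: "z \<in> C"
    using C_closed[OF u'(1), of z] zy(1) zD[OF uD] u'V sg by (auto simp: nb_def sgraph_def)
  have y_u: "\<not> E u y" using D_closed[OF uD] zy(3) yD by blast
  have yC: "y \<in> C"
    using C_closed[OF zC zy(4) yV(1) y_u] yD uD by blast
  \<comment> \<open>A walk from \<open>y\<close> in \<open>far u'\<close> cannot enter
    \<open>D\<close>, hence never meets a neighbour of \<open>u\<close> and stays in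
    \<open>C\<close>. It also misses \<open>u'\<close>, so the inclusion in \<open>C\<close> is
    strict.\<close>
  have "comp E (far u') y \<subseteq> C \<inter> far u' - D"
  proof (rule comp_least)
    show "y \<in> C \<inter> far u' - D" using yC yD zy(3) by (auto simp: far_def)
    fix a b assume ab: "a \<in> C \<inter> far u' - D" "b \<in> far u'" "E a b"
    then have "b \<notin> D" using D_closed[of b a] sg by (auto simp: sgraph_def)
    moreover have "\<not> E u b" using D_closed[OF uD] ab \<open>b \<notin> D\<close> by blast
    moreover have "b \<noteq> u" using \<open>b \<notin> D\<close> uD by blast
    ultimately show "b \<in> C \<inter> far u' - D" using C_closed[of a b] ab by (auto simp: far_def)
  qed
  moreover have "u' \<notin> far u'" by (simp add: far_def)
  ultimately have "comp E (far u') y \<subset> C" using u' by blast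
  then have "card (comp E (far u') y) < card C"
    using C fin by (intro psubset_card_mono) (auto simp: far_def intro: finite_subset)
  moreover have "ok (u', y)" using u' zy by (simp add: ok_def)
  ultimately show False using p(2)[of "(u', y)"] by (simp add: size_at_def C_def)
qed

end

section \<open>Mader's edge bound\<close>

text \<open>Violation of Mader's bound, doubled and rearranged to avoid truncated
  subtraction.\<close>

definition dense :: "nat \<Rightarrow> 'a set \<Rightarrow> ('a \<Rightarrow> 'a \<Rightarrow> bool) \<Rightarrow> bool" where
  "dense r V E \<longleftrightarrow> r - 2 \<le> card V \<and> 2 * (r - 2) * card V < arcs E V + (r - 1) * (r - 2)"

lemma arcs_mono:
  assumes "sgraph E" "finite W" "X \<subseteq> W"
  shows "arcs E X \<le> arcs E W"
  using arcs_Un[of E X "W - X"] assms by (auto simp: Un_absorb1 finite_subset)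

lemma arcs_delete_edge:
  assumes "sgraph E" "finite W" "x \<in> W" "y \<in> W" "E x y"
  defines "E' \<equiv> \<lambda>a b. E a b \<and> {a, b} \<noteq> {x, y}"
  shows "sgraph E'" "arcs E' W + 2 = arcs E W"
proof -
  show E': "sgraph E'" using assms by (auto simp: sgraph_def E'_def insert_commute)
  have "x \<noteq> y" using assms by (auto simp: sgraph_def)
  have "star E' x {y} = E"
    using assms(1,5) by (auto simp: fun_eq_iff star_def E'_def doubleton_eq_iff sgraph_def)
  moreover have "{s \<in> {y} \<inter> W. s \<noteq> x \<and> \<not> E' x s} = {y}"
    using assms \<open>x \<noteq> y\<close> by (auto simp: E'_def)
  ultimately show "arcs E' W + 2 = arcs E W"
    using arcs_star[OF E' assms(2,3), of "{y}"] by simp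
qed

lemma KM_if_dense:
  fixes V :: "'a set"
  assumes r: "3 \<le> r" "r \<le> 7"
    and loc: "\<And>(H :: 'a set) F S. local_config r H F S \<Longrightarrow> star_minor (r - 1) H F S"
    and "finite V" "sgraph E" "dense r V E"
  shows "KM r V E"
  using assms(4-)
proof (induction "card V + arcs E V" arbitrary: V E rule: less_induct)
  case less
  note fin = less.prems(1) and sg = less.prems(2)
  define n where "n = card V"
  define q where "q = r - 2"
  have q: "r = q + 2" "1 \<le> q" using r by (auto simp: q_def)
  have big: "2 * q * n < arcs E V + (q + 1) * q" "q \<le> n"
    using less.prems(3) q by (auto simp: dense_def n_def)
  show ?case
  proof (rule ccontr)
    assume free: "\<not> KM r V E"
    \<comment> \<open>A complete graph on \<open>q\<close> vertices meets the bound exactly, so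
      \<open>n = q\<close> cannot violate it.\<close>
    have n: "q + 1 \<le> n"
    proof (rule ccontr)
      assume "\<not> q + 1 \<le> n"
      then have "n = q" using big by simp
      moreover have "q * (q - 1) + (q + 1) * q = 2 * q * q"
        using q(2) by (cases q) auto
      ultimately show False using big arcs_le[OF sg fin] n_def by simp
    qed
    \<comment> \<open>Minimality: no smaller graph whose minors lift to \<open>V\<close> violates
      the bound.\<close>
    have sub: False if "card V' + arcs E' V' < card V + arcs E V" "finite V'" "sgraph E'"
      "q \<le> card V'" "2 * q * card V' < arcs E' V' + (q + 1) * q"
      "KM r V' E' \<Longrightarrow> KM r V E"
      for V' :: "'a set" and E' :: "'a \<Rightarrow> 'a \<Rightarrow> bool"
      using less.hyps[OF that(1-3)] that(4-6) free q by (simp add: dense_def)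
    \<comment> \<open>With more arcs, deleting any edge would leave a smaller violation.\<close>
    have exact: "arcs E V + (q + 1) * q \<le> 2 * q * n + 2"
    proof (rule ccontr)
      assume many: "\<not> ?thesis"
      have "q * (q + 1) \<le> 2 * q * n" using n q mult_le_mono[of "q" "2*q" "q+1" n] by simp
      then have "arcs E V \<noteq> 0" using many by (simp add: algebra_simps)
      then obtain x where x: "x \<in> V" "nb E V x \<noteq> {}"
        unfolding arcs_def by (metis card.empty sum.neutral)
      then obtain y where y: "y \<in> V" "E x y" by (auto simp: nb_def)
      show False
        by (rule sub[of V "\<lambda>a b. E a b \<and> {a, b} \<noteq> {x, y}"])
          (use arcs_delete_edge[OF sg fin x(1) y] many big fin in \<open>auto simp: n_def elim: KM_mono\<close>)
    qed
    \<comment> \<open>Dropping a vertex lowers the bound by \<open>2 * q\<close>, and one of degree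
      at most \<open>q\<close> costs at most \<open>2 * q\<close> arcs.\<close>
    have mindeg: "q + 1 \<le> card (nb E V v)" if v: "v \<in> V" for v
    proof (rule ccontr)
      assume small: "\<not> ?thesis"
      have c: "card (V - {v}) + 1 = n" using v fin n_def card_Suc_Diff1[of V v] by simp
      then have "2 * q * n = 2 * q * card (V - {v}) + 2 * q" by (metis distrib_left mult.right_neutral)
      then show False
        by (intro sub[of "V - {v}" E])
          (use arcs_remove[OF sg fin v] small big fin sg n c in \<open>auto simp: n_def elim: KM_mono\<close>)
    qed
    \<comment> \<open>Contracting an edge with fewer than \<open>q\<close> common neighbours also
      costs at most \<open>2 * q\<close> arcs.\<close>
    have tri: "q \<le> card (nb E V x \<inter> nb E V y)" if xy: "x \<in> V" "y \<in> V" "E x y" for x y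
    proof (rule ccontr)
      assume small: "\<not> ?thesis"
      have "x \<noteq> y" using xy sg by (auto simp: sgraph_def)
      have c: "card (V - {y}) + 1 = n" using xy fin n_def card_Suc_Diff1[of V y] by simp
      then have e: "2 * q * n = 2 * q * card (V - {y}) + 2 * q" by (metis distrib_left mult.right_neutral)
      show False
      proof (rule sub[of "V - {y}" "star E x (Collect (E y))"])
        show "KM r V E" if "KM r (V - {y}) (star E x (Collect (E y)))"
          using KM.contr[of x V y E r] xy \<open>x \<noteq> y\<close> that by blast
      qed (use arcs_contract[OF sg fin xy] small big fin sgraph_star[OF sg] n c e in \<open>auto simp: n_def\<close>)
    qed
    have "V \<noteq> {}" using n n_def by auto
    \<comment> \<open>Without low vertices \<open>arcs E V\<close> is at least
      \<open>2 * q * n\<close>, which contradicts \<open>exact\<close> once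
      \<open>(q + 1) * q\<close> exceeds 2. This fails for \<open>q = 1\<close>, where a triangle is
      exhibited directly.\<close>
    show False
    proof (cases "q = 1")
      case True
      obtain x where x: "x \<in> V" using \<open>V \<noteq> {}\<close> by blast
      then have "nb E V x \<noteq> {}" using mindeg[OF x] by auto
      then obtain y where y: "y \<in> V" "E x y" by (auto simp: nb_def)
      then have "nb E V x \<inter> nb E V y \<noteq> {}" using tri[OF x y] True by auto
      then obtain z where z: "z \<in> V" "E x z" "E y z" by (auto simp: nb_def)
      have "KM 3 V E"
        by (rule KM.clique[of "{x, y, z}"])
          (use x y z sg in \<open>auto simp: sgraph_def card_insert_if\<close>)
      then show False using free True q by (simp add: numeral_3_eq_3)
    next
      case False
      interpret locally_dense V E r
      proof
        fix X assume X: "X \<subset> V" "r - 2 \<le> card X"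
        then have "card X < card V" "finite X" using fin by (auto intro: psubset_card_mono finite_subset)
        moreover have "arcs E X \<le> arcs E V" using arcs_mono[OF sg fin, of X] X by blast
        ultimately show "arcs E X + (r - 1) * (r - 2) \<le> 2 * (r - 2) * card X"
          using sub[of X E] X sg KM_mono[of r X E V E] q by fastforce
      next
        fix u assume "u \<in> V"
        then show "nb E V u \<noteq> {}" using mindeg[of u] by auto
      qed (use r fin sg loc tri free q in auto)
      have "2 * q \<le> card (nb E V u)" if "u \<in> V" for u
        using no_low_vertex[of u] that q unfolding low_def by simp
      then have "2 * q * n \<le> arcs E V" using arcs_ge[OF fin] n_def by blast
      moreover have "3 * 2 \<le> (q + 1) * q" using False q by (intro mult_le_mono) auto
      ultimately show False using exact by simp
    qed
  qed
qed

section \<open>Neighbourhoods of low-degree vertices\<close>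

lemma KM_nb:
  assumes "sgraph E" "z \<in> H" "KM s (nb E H z) E"
  shows "KM (Suc s) H E"
proof -
  have "KM (Suc s) (insert z (nb E H z)) E"
    by (rule KM_insert_dominating[OF assms(3)]) (use assms in \<open>auto simp: nb_def sgraph_def\<close>)
  then show ?thesis by (rule KM_mono) (use assms in \<open>auto simp: nb_def\<close>)
qed

lemma local_degree_card:
  assumes "local_config r H E S" "3 \<le> r"
  shows "r - 1 \<le> card H"
proof -
  obtain x where x: "x \<in> H" using assms by (auto simp: local_config_def)
  then have "r - 2 \<le> card H - 1"
    using assms card_nb_le[of E H x] unfolding local_config_def by fastforce
  moreover have "0 < card H" using x assms by (auto simp: local_config_def card_gt_0_iff)
  ultimately show ?thesis using assms(2) by linarith
qed

section \<open>Local statement and Mader's bound for \<open>r\<close> up to 5\<close>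

lemma local_3: "\<not> local_config 3 H E S"
  using local_degree_card[of 3 H E S] by (auto simp: local_config_def)

text \<open>First rung of a ladder: the local statement for \<open>r\<close> gives Mader's bound for
  \<open>r\<close>, and bounds for smaller values prove the local statement for larger
  \<open>r\<close>.\<close>

lemma mader_3: "finite V \<Longrightarrow> sgraph E \<Longrightarrow> dense 3 V E \<Longrightarrow> KM 3 V E"
  using local_3 by (intro KM_if_dense) auto

lemma local_4: "local_config 4 H E S \<Longrightarrow> star_minor (4 - 1) H E S"
proof -
  assume c: "local_config 4 H E S"
  have "2 * card H \<le> arcs E H" using c by (intro arcs_ge) (auto simp: local_config_def)
  moreover have "1 \<le> card H" using c by (auto simp: local_config_def card_gt_0_iff Suc_le_eq)
  ultimately have "dense 3 H E" using c by (simp add: dense_def local_config_def)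
  then show ?thesis using c mader_3[of H E] by (simp add: star_minor_def local_config_def)
qed

lemma mader_4: "finite V \<Longrightarrow> sgraph E \<Longrightarrow> dense 4 V E \<Longrightarrow> KM 4 V E"
  using local_4 by (intro KM_if_dense) auto

text \<open>Minimum degree 3 gives \<open>3 * card H\<close> arcs, above the bound
  \<open>4 * card H - 6\<close> because \<open>card H \<le> 5\<close>.\<close>

lemma local_5: "local_config 5 H E S \<Longrightarrow> star_minor (5 - 1) H E S"
proof -
  assume c: "local_config 5 H E S"
  have "3 * card H \<le> arcs E H" using c by (intro arcs_ge) (auto simp: local_config_def)
  then have "dense 4 H E"
    using c local_degree_card[OF c] by (simp add: dense_def local_config_def)
  then show ?thesis using c mader_4[of H E] by (simp add: star_minor_def local_config_def)
qed

lemma mader_5: "finite V \<Longrightarrow> sgraph E \<Longrightarrow> dense 5 V E \<Longrightarrow> KM 5 V E"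
  using local_5 by (intro KM_if_dense) auto

section \<open>Local statement for \<open>r = 6\<close> and \<open>r = 7\<close>\<close>

lemma obtain_min_degree:
  assumes "S \<noteq> {}"
  obtains v where "v \<in> S" "\<And>x. x \<in> S \<Longrightarrow> card (nb E H v) \<le> card (nb E H x)"
  using ex_has_least_nat[of "\<lambda>v. v \<in> S" _ "\<lambda>v. card (nb E H v)"] assms by blast

text \<open>A star at \<open>v \<in> S\<close> makes \<open>v\<close> adjacent to all of \<open>H\<close>, so \<open>v\<close> and \<open>z\<close> extend a \<open>K\<^bsub>r-3\<^esub>\<close> minor of the rest.\<close>

lemma local_all_dominating:
  assumes c: "local_config r H E S" and r: "r = 6 \<or> r = 7"
    and z: "z \<in> H - S" and dom: "\<And>z. z \<in> H - S \<Longrightarrow> nb E H z = H - {z}"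
    and mader: "\<And>W. finite W \<Longrightarrow> dense (r - 3) W E \<Longrightarrow> KM (r - 3) W E"
  shows "star_minor (r - 1) H E S"
proof (cases "S = {}")
  case True
  have "r - 1 \<le> card H" using local_degree_card[OF c] r by auto
  then obtain A where A: "A \<subseteq> H" "card A = r - 1" "finite A" by (rule obtain_subset_with_card_n)
  have "KM (r - 1) H E"
    by (rule KM.clique[OF A(1,3,2)]) (use dom A(1) True in \<open>auto simp: nb_def\<close>)
  then show ?thesis by (simp add: star_minor_def)
next
  case False
  have fin: "finite H" and sg: "sgraph E" and S: "S \<subseteq> H"
    and deg: "\<And>x. x \<in> H \<Longrightarrow> r - 2 \<le> card (nb E H x)"
    using c by (auto simp: local_config_def)
  define n where "n = card H"
  have n: "r - 1 \<le> n" using local_degree_card[OF c] r n_def by auto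
  obtain v where v: "v \<in> S" "\<And>x. x \<in> S \<Longrightarrow> card (nb E H v) \<le> card (nb E H x)"
    using obtain_min_degree[OF False, where E = E and H = H] by blast
  define m where "m = card (nb E H v)"
  have m: "r - 2 \<le> m" unfolding m_def using deg v S by blast
  have "m \<le> n - 1"
    using card_nb_le[OF sg fin, of v] v S by (auto simp: m_def n_def)
  then have mindeg: "m \<le> card (nb E H x)" if "x \<in> H" for x
    using that v dom[of x] fin m_def n_def by (cases "x \<in> S") auto
  have zv: "z \<noteq> v" "v \<in> H" "z \<in> H" "E z v" using z v S dom[OF z] by (auto simp: nb_def)
  define R where "R = H - {z} - {v}"
  have cardR: "card R = n - 2" using zv fin by (simp add: R_def n_def)
  have degJ: "card (nb E H x) = Suc (card (nb E (H - {z}) x))" if "x \<in> H - {z}" for x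
  proof -
    have "z \<in> nb E H x" using that dom[OF z] sg zv by (auto simp: nb_def sgraph_def)
    moreover have "nb E (H - {z}) x = nb E H x - {z}" by (auto simp: nb_def)
    ultimately show ?thesis using fin by (metis card_Suc_Diff1 finite_nb)
  qed
  \<comment> \<open>\<open>H - {z}\<close> has \<open>n - 1\<close> vertices and minimum degree at
    least \<open>m - 1\<close>; deleting \<open>v\<close> costs \<open>2 * (m - 1)\<close>
    arcs.\<close>
  have "(m - 1) * card (H - {z}) \<le> arcs E (H - {z})"
    using fin mindeg degJ by (intro arcs_ge) fastforce+
  moreover have "arcs E (H - {z}) = arcs E R + 2 * (m - 1)"
    using arcs_remove[OF sg, of "H - {z}" v] fin zv degJ[of v] by (simp add: R_def m_def)
  moreover have "card (H - {z}) = (n - 3) + 2" using zv fin n r by (auto simp: n_def)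
  ultimately have "(m - 1) * (n - 3) \<le> arcs E R" by (simp add: algebra_simps)
  moreover have "(r - 3) * (n - 3) \<le> (m - 1) * (n - 3)" using m by (intro mult_right_mono) auto
  ultimately have "(r - 3) * (n - 3) \<le> arcs E R" by linarith
  \<comment> \<open>The check is 2(n-2) < 3(n-3) + 2 for \<open>r = 6\<close> and 4(n-2) < 4(n-3) +
    6 for \<open>r = 7\<close>.\<close>
  then have "dense (r - 3) R E"
    using r n cardR by (auto simp: dense_def)
  then have "KM (r - 3) R E" using mader[of R] fin by (simp add: R_def)
  then have "KM (r - 3) R (star E v S)" by (rule KM_mono) (auto simp: star_def)
  then have "KM (Suc (r - 3)) (insert v R) (star E v S)"
  proof (rule KM_insert_dominating)
    fix w assume w: "w \<in> R"
    have "E v w \<and> E w v" if "w \<notin> S"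
    proof -
      have "v \<in> nb E H w" using dom[of w] that w zv by (auto simp: R_def)
      then show ?thesis using sg by (auto simp: nb_def sgraph_def)
    qed
    then show "star E v S v w \<and> star E v S w v" using w by (auto simp: star_def R_def)
  qed (simp add: R_def)
  then have "KM (Suc (Suc (r - 3))) (insert z (insert v R)) (star E v S)"
  proof (rule KM_insert_dominating)
    show "star E v S z w \<and> star E v S w z" if "w \<in> insert v R" for w
    proof -
      have "w \<in> nb E H z" using dom[OF z] that zv by (auto simp: R_def)
      then show ?thesis using sg by (auto simp: nb_def star_def sgraph_def)
    qed
  qed (use zv in \<open>simp add: R_def\<close>)
  moreover have "insert z (insert v R) = H" "Suc (Suc (r - 3)) = r - 1"
    using zv r by (auto simp: R_def)
  ultimately show ?thesis using v by (auto simp: star_minor_def)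
qed

lemma KM_star_all:
  assumes "v \<in> H" "KM s (H - {v}) E"
  shows "KM (Suc s) H (star E v H)"
proof -
  have "KM s (H - {v}) (star E v H)" using assms(2) by (rule KM_mono) (auto simp: star_def)
  then have "KM (Suc s) (insert v (H - {v})) (star E v H)"
    by (rule KM_insert_dominating) (auto simp: star_def)
  then show ?thesis using assms(1) by (simp add: insert_absorb)
qed

lemma nb_nb_degree:
  assumes "local_config r H E S" "z \<in> H - S" "w \<in> nb E H z"
  shows "r - 3 \<le> card (nb E (nb E H z) w)"
proof -
  have "nb E (nb E H z) w = nb E H z \<inter> nb E H w" using assms by (auto simp: nb_def)
  then show ?thesis using assms by (auto simp: local_config_def nb_def)
qed

text \<open>If \<open>S = H\<close>, a vertex of minimum degree can be spared and then dominates
  through its star. A vertex of \<open>H - S\<close> of degree at most 5 has a neighbourhood dense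
  enough for \<open>mader_4\<close>. Otherwise all of \<open>H - S\<close> dominates
  \<open>H\<close>.\<close>

lemma local_6: "local_config 6 H E S \<Longrightarrow> star_minor (6 - 1) H E S"
proof -
  assume c: "local_config 6 H E S"
  have fin: "finite H" and sg: "sgraph E" and S: "S \<subseteq> H" and H: "H \<noteq> {}" "card H \<le> 7"
    and deg: "\<And>x. x \<in> H \<Longrightarrow> 4 \<le> card (nb E H x)"
    using c by (auto simp: local_config_def)
  show ?thesis
  proof (cases "S = H")
    case True
    obtain v where v: "v \<in> H" "\<And>x. x \<in> H \<Longrightarrow> card (nb E H v) \<le> card (nb E H x)"
      using obtain_min_degree[OF H(1), where E = E and H = H] by blast
    define m where "m = card (nb E H v)"
    have m: "4 \<le> m" using deg v m_def by simp
    have n: "5 \<le> card H" using local_degree_card[OF c] by simp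
    have "m * card H \<le> arcs E H" using arcs_ge[OF fin v(2)] m_def by simp
    moreover have "arcs E H = arcs E (H - {v}) + 2 * m" using arcs_remove[OF sg fin v(1)] m_def by simp
    moreover have "m * card H = m * (card H - 2) + 2 * m"
      using n by (simp add: algebra_simps flip: distrib_left)
    moreover have "4 * (card H - 2) \<le> m * (card H - 2)" using m by simp
    ultimately have "4 * (card H - 2) \<le> arcs E (H - {v})" by linarith
    then have "dense 4 (H - {v}) E" using n v(1) fin by (simp add: dense_def) arith
    then have "KM 4 (H - {v}) E" using mader_4 fin sg by blast
    then show ?thesis using KM_star_all[OF v(1), of 4 E] v(1) True by (auto simp: star_minor_def)
  next
    case False
    show ?thesis
    proof (cases "\<exists>z\<in>H - S. card (nb E H z) \<le> 5")
      case True
      then obtain z where z: "z \<in> H - S" "card (nb E H z) \<le> 5" by blast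
      have "3 * card (nb E H z) \<le> arcs E (nb E H z)"
        using nb_nb_degree[OF c z(1)] fin by (intro arcs_ge) auto
      then have "dense 4 (nb E H z) E" using z deg[of z] by (auto simp: dense_def)
      then have "KM 4 (nb E H z) E" using mader_4[of "nb E H z" E] fin sg by simp
      then show ?thesis using KM_nb[OF sg, of z H 4] z by (simp add: star_minor_def)
    next
      case no_small: False
      have "nb E H z = H - {z}" if "z \<in> H - S" for z
      proof (rule card_seteq)
        show "nb E H z \<subseteq> H - {z}" using sg by (auto simp: nb_def sgraph_def)
        have "\<not> card (nb E H z) \<le> 5" using no_small that by blast
        then show "card (H - {z}) \<le> card (nb E H z)" using that H(2) by simp
      qed (use fin in simp)
      moreover obtain z where "z \<in> H - S" using False S by blast
      ultimately show ?thesis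
        using local_all_dominating[OF c, of z] mader_3[OF _ sg] by simp
    qed
  qed
qed

text \<open>Edge counting leaves only the case that all vertices but at most one have degree 5. There
  contracting an edge of \<open>H - v\<close> forces every edge into three triangles, and \<open>N[x]\<close> contains
  the minor for any \<open>x\<close> of degree 5.\<close>

lemma KM5_delete_vertex:
  assumes fin: "finite H" and sg: "sgraph E" and n: "7 \<le> card H" "card H \<le> 9"
    and deg: "\<And>x. x \<in> H \<Longrightarrow> 5 \<le> card (nb E H x)"
  shows "\<exists>v\<in>H. KM 5 (H - {v}) E"
proof (rule ccontr)
  assume none: "\<not> ?thesis"
  define n where "n = card H"
  have n: "7 \<le> n" "n \<le> 9" using assms n_def by auto
  have "H \<noteq> {}" using n n_def by auto
  then obtain v where v: "v \<in> H" "\<And>x. x \<in> H \<Longrightarrow> card (nb E H v) \<le> card (nb E H x)"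
    using obtain_min_degree[where S = H and E = E and H = H] by blast
  define m where "m = card (nb E H v)"
  have total: "m * n \<le> arcs E H" using arcs_ge[OF fin v(2)] m_def n_def by simp
  have rem: "arcs E H = arcs E (H - {v}) + 2 * m" using arcs_remove[OF sg fin v(1)] m_def by simp
  have few: "arcs E (H - {v}) + 12 \<le> 6 * (n - 1)"
    using none mader_5[of "H - {v}" E] v(1) fin sg n by (force simp: dense_def n_def)
  \<comment> \<open>If \<open>m\<close> were at least 6, \<open>H - {v}\<close> would have at least
    \<open>6 * (n - 2)\<close> arcs, more than \<open>few\<close> allows.\<close>
  have m: "m = 5"
  proof (rule ccontr)
    assume "m \<noteq> 5"
    then have "6 \<le> m" using deg[OF v(1)] m_def by simp
    then have "6 * (n - 2) \<le> m * (n - 2)" by simp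
    moreover have "m * (n - 2) + 2 * m = m * (n - 2 + 2)" by (metis distrib_left mult.commute)
    moreover have "n - 2 + 2 = n" using n by simp
    ultimately have "6 * (n - 2) + 2 * m \<le> m * n" by (metis add_le_cancel_right)
    then show False using total rem few n by linarith
  qed
  have arcsH: "5 * n \<le> arcs E H" "arcs E H + 8 \<le> 6 * n" using total rem few m n by (simp, linarith)
  define T where "T = {x \<in> H. card (nb E H x) \<noteq> 5}"
  have "(\<Sum>x\<in>H. 5 + (if x \<in> T then 1 else 0)) \<le> arcs E H"
    unfolding arcs_def using deg by (intro sum_mono) (force simp: T_def)
  moreover have "(\<Sum>x\<in>H. (5::nat) + (if x \<in> T then 1 else 0)) = 5 * n + card T"
    using fin by (simp add: sum.distrib n_def T_def sum.If_cases Int_def)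
  \<comment> \<open>The degree sum exceeds \<open>5 * n\<close> by at most \<open>n - 8\<close>, and
    \<open>n \<le> 9\<close>.\<close>
  ultimately have cardT: "card T \<le> 1" using arcsH n by linarith
  have finT: "finite T" using fin T_def by simp
  have regular: "\<exists>v\<in>A. v \<in> H - T" if "A \<subseteq> H" "2 \<le> card A" for A
  proof (rule ccontr)
    assume "\<not> ?thesis"
    then have "A \<subseteq> T" using that by blast
    then show False using card_mono[OF finT, of A] that(2) cardT by linarith
  qed
  \<comment> \<open>With at most one common neighbour off \<open>v\<close>, contraction leaves at
    least 5n - 14 arcs on \<open>n - 2\<close> vertices, and 5n - 14 > 6(n-2) - 12 as
    \<open>n \<le> 9\<close>.\<close>
  have common: "2 \<le> card (nb E H x \<inter> nb E H y - {v})"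
    if xy: "x \<in> H" "y \<in> H" "E x y" and v: "v \<in> H - T" "v \<noteq> x" "v \<noteq> y" for x y v
  proof (rule ccontr)
    assume small: "\<not> ?thesis"
    let ?F = "star E x (Collect (E y))"
    have "nb E (H - {v}) x \<inter> nb E (H - {v}) y = nb E H x \<inter> nb E H y - {v}"
      by (auto simp: nb_def)
    then have "arcs ?F (H - {v} - {y}) + 2 + 2 * card (nb E H x \<inter> nb E H y - {v}) = arcs E (H - {v})"
      using arcs_contract[OF sg, of "H - {v}" x y] xy v fin by simp
    moreover have "arcs E H = arcs E (H - {v}) + 10"
      using arcs_remove[OF sg fin, of v] v by (simp add: T_def)
    moreover have "card (H - {v} - {y}) = n - 2" using v xy fin by (simp add: n_def)
    ultimately have "dense 5 (H - {v} - {y}) ?F"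
      using small arcsH n unfolding dense_def by simp arith
    then have "KM 5 (H - {v} - {y}) ?F"
      using mader_5 fin sgraph_star[OF sg] by blast
    then have "KM 5 (H - {v}) E"
      using KM.contr[of x "H - {v}" y E 5] xy v sgraph_irrefl[OF sg] by blast
    then show False using none v by blast
  qed
  have three: "3 \<le> card (nb E H x \<inter> nb E H y)" if xy: "x \<in> H" "y \<in> H" "E x y" for x y
  proof -
    have "x \<noteq> y" using xy(3) sgraph_irrefl[OF sg] by blast
    then have "card (H - {x} - {y}) = n - 2" using xy fin by (simp add: n_def)
    then have "2 \<le> card (H - {x} - {y})" using n by linarith
    then obtain v where "v \<in> H - {x} - {y}" "v \<in> H - T"
      using regular[of "H - {x} - {y}"] by auto
    then have "2 \<le> card (nb E H x \<inter> nb E H y - {v})" using common[OF xy, of v] by simp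
    also have "\<dots> \<le> card (nb E H x \<inter> nb E H y)" using fin by (intro card_mono) auto
    \<comment> \<open>Of two common neighbours one has degree 5; applying \<open>common\<close> with
      this one removed yields two more.\<close>
    finally obtain w where w: "w \<in> nb E H x \<inter> nb E H y" "w \<in> H - T"
      using regular[of "nb E H x \<inter> nb E H y"] by (auto simp: nb_def)
    then have "w \<noteq> x" "w \<noteq> y" using sg by (auto simp: nb_def sgraph_def)
    then have "2 \<le> card (nb E H x \<inter> nb E H y - {w})" using common[OF xy w(2)] by simp
    then show ?thesis using w(1) fin card_Suc_Diff1[of "nb E H x \<inter> nb E H y" w] by simp
  qed
  obtain x where x: "x \<in> H - T" using regular[of H] n n_def by auto
  define A where "A = nb E H x"
  have A: "card A = 5" "A \<subseteq> H" "finite A" "x \<notin> A"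
    using x fin sg by (auto simp: T_def A_def nb_def sgraph_def)
  have "3 \<le> card (nb E A w)" if "w \<in> A" for w
  proof -
    have "nb E A w = nb E H x \<inter> nb E H w" by (auto simp: A_def nb_def)
    then show ?thesis using three[of x w] that x by (auto simp: A_def nb_def)
  qed
  then have "3 * 5 \<le> arcs E A" using arcs_ge[OF A(3), of 3] A(1) by simp
  then have "KM 4 A E" using A(1,3) sg by (intro mader_4) (auto simp: dense_def)
  then have "KM (Suc 4) (insert x A) E"
    by (rule KM_insert_dominating) (use A sg in \<open>auto simp: A_def nb_def sgraph_def\<close>)
  moreover obtain v where v: "v \<in> H" "v \<notin> insert x A"
  proof -
    have "card (insert x A) = 6" using A by simp
    then have "\<not> H \<subseteq> insert x A" using card_mono[of "insert x A" H] A n n_def by fastforce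
    then show ?thesis using that by blast
  qed
  ultimately have "KM 5 (H - {v}) E"
    using KM_mono[of 5 "insert x A" E "H - {v}" E] x A by auto
  then show False using none v by blast
qed

text \<open>The non-adjacent pairs of \<open>A\<close> not inside \<open>P\<close> meet the at most two vertices of \<open>A - P\<close>, so
  enough of them lie inside \<open>P\<close> for the star at some vertex of \<open>P\<close> to exceed Mader's bound.\<close>

lemma star_gain:
  assumes fin: "finite A" and sg: "sgraph E" and d: "card A = 6 \<or> card A = 7"
    and deg: "\<And>x. x \<in> A \<Longrightarrow> 4 \<le> card (nb E A x)"
    and P: "P \<subseteq> A" "card A \<le> card P + 2"
  shows "\<exists>w\<in>P. dense 5 A (star E w P)"
proof (rule ccontr)
  assume none: "\<not> ?thesis"
  define d where "d = card A"
  define N where "N = (\<lambda>a b. a \<noteq> b \<and> \<not> E a b)"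
  have sgN: "sgraph N" using sg by (auto simp: N_def sgraph_def)
  have finP: "finite P" "finite (A - P)" using fin P finite_subset by auto
  have compl: "card (nb N A x) + card (nb E A x) = d - 1" if "x \<in> A" for x
  proof -
    have "nb N A x \<union> nb E A x = A - {x}" "nb N A x \<inter> nb E A x = {}"
      using that sg by (auto simp: N_def nb_def sgraph_def)
    then show ?thesis using fin that
      by (metis card_Diff_singleton card_Un_disjoint d_def finite_nb)
  qed
  have pairs: "arcs N A + arcs E A = d * (d - 1)"
    using compl by (simp add: arcs_def d_def flip: sum.distrib)
  have gain: "arcs E A + 2 * card (nb N P w) \<le> 6 * d - 12" if "w \<in> P" for w
  proof -
    have "{s \<in> P \<inter> A. s \<noteq> w \<and> \<not> E w s} = nb N P w" using P by (auto simp: nb_def N_def)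
    then have "arcs (star E w P) A = arcs E A + 2 * card (nb N P w)"
      using arcs_star[OF sg fin, of w P] that P by auto
    then show ?thesis using none that assms(3) by (force simp: dense_def d_def)
  qed
  have "2 * arcs N P = (\<Sum>w\<in>P. 2 * card (nb N P w))" by (simp add: arcs_def sum_distrib_left)
  also have "\<dots> \<le> (\<Sum>w\<in>P. 6 * d - 12 - arcs E A)"
    using gain by (intro sum_mono) fastforce
  finally have inside: "2 * arcs N P \<le> card P * (6 * d - 12 - arcs E A)" by simp
  have "(\<Sum>a\<in>A - P. card (nb N (A - P \<union> P) a)) \<le> (\<Sum>a\<in>A - P. d - 5)"
    using compl deg P by (intro sum_mono) (fastforce simp: Un_absorb2)
  then have outside: "arcs N (A - P) + (\<Sum>a\<in>A - P. card (nb N P a)) \<le> card (A - P) * (d - 5)"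
    using sum_card_nb_Un[OF finP(2,1), of N] by (simp add: Int_commute del: Un_Diff_cancel2)
  have split: "arcs N A = arcs N (A - P) + arcs N P + 2 * (\<Sum>a\<in>A - P. card (nb N P a))"
    using arcs_Un[OF sgN finP(2,1)] P by (auto simp: Un_absorb2)
  have cards: "card (A - P) + card P = d" "card (A - P) \<le> 2"
    using P finP card_mono[OF fin P(1)] by (auto simp: card_Diff_subset d_def)
  have "P \<noteq> {}" using P d by auto
  then have "arcs E A \<le> 6 * d - 12" using gain by fastforce
  \<comment> \<open>\<open>s\<close> is the slack of \<open>E\<close> below the bound; the sum over
    \<open>P\<close> limits the non-adjacent pairs inside \<open>P\<close> in terms of
    \<open>s\<close>, and minimum degree 4 limits \<open>s\<close> to
    \<open>2 * d - 12\<close>.\<close>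
  then obtain s where s: "6 * d - 12 = arcs E A + s" using le_Suc_ex by blast
  then have inside: "2 * arcs N P \<le> card P * s" using inside unfolding s by simp
  have "4 * d \<le> arcs E A" using arcs_ge[OF fin deg] d_def by simp
  then have "2 * (d * (d - 1)) + 2 * s \<le> card P * s + 4 * (card (A - P) * (d - 5)) + 2 * (6 * d - 12)"
    "4 * d + s \<le> 6 * d - 12"
    using pairs split outside inside s by linarith+
  moreover have "card (A - P) = 0 \<or> card (A - P) = 1 \<or> card (A - P) = 2" using cards by linarith
  moreover have "card P = d - card (A - P)" using cards by linarith
  ultimately show False using d d_def by (elim disjE) auto
qed

text \<open>Five neighbours of \<open>z\<close> already carry a 5-clique minor. Otherwise some
  \<open>p\<close> is not adjacent to \<open>z\<close>, and contracting \<open>p\<close> into a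
  suitable neighbour of \<open>z\<close> adds the star that lifts the neighbourhood above the
  bound.\<close>

lemma KM6_of_low_vertex:
  assumes fin: "finite H" and sg: "sgraph E" and n: "card H \<le> 9"
    and deg: "\<And>x. x \<in> H \<Longrightarrow> 5 \<le> card (nb E H x)"
    and z: "z \<in> H" and nbz: "\<And>w. w \<in> nb E H z \<Longrightarrow> 4 \<le> card (nb E (nb E H z) w)"
    and small: "card (nb E H z) = 5 \<or> nb E H z \<noteq> H - {z}"
  shows "KM 6 H E"
proof -
  define A where "A = nb E H z"
  have finA: "finite A" using fin A_def by simp
  have zA: "z \<notin> A" "A \<subseteq> H" using sg by (auto simp: A_def nb_def sgraph_def)
  have arcsA: "4 * card A \<le> arcs E A" using arcs_ge[OF finA] nbz A_def by blast
  show ?thesis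
  proof (cases "card A = 5")
    case True
    then have "KM 5 A E" using arcsA finA sg by (intro mader_5) (auto simp: dense_def)
    then show ?thesis using KM_nb[OF sg z, of 5] A_def by simp
  next
    case False
    define B where "B = H - insert z A"
    obtain p where p: "p \<in> B" using small False zA unfolding A_def B_def by (auto simp: nb_def)
    have finB: "finite B" "A \<inter> B = {}" using fin by (auto simp: B_def)
    have cardH: "card H = card A + 1 + card B"
      using zA z fin finA card_Diff_subset[of "insert z A" H] card_mono[of H "insert z A"]
      by (simp add: B_def)
    have B: "1 \<le> card B" using p finB by (auto simp: Suc_le_eq card_gt_0_iff)
    then have d: "card A = 6 \<or> card A = 7" using False deg[OF z] cardH n A_def by force
    have Ezp: "\<not> E z p" "\<not> E p z" "p \<in> H" "p \<noteq> z" "p \<notin> A"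
      using p sg by (auto simp: B_def A_def nb_def sgraph_def)
    have "nb E H p = nb E (A \<union> B) p" using Ezp z zA by (auto simp: B_def nb_def)
    then have "5 \<le> card (nb E A p) + card (nb E B p)"
      using deg[OF Ezp(3)] card_nb_Un[OF finA finB, of E p] by simp
    \<comment> \<open>\<open>p\<close> has at most \<open>card B - 1\<close> neighbours in
      \<open>B\<close>, while \<open>card A + card B \<le> 8\<close>.\<close>
    then have "card A \<le> card (nb E A p) + 2"
      using card_nb_le[OF sg finB(1) p] B cardH n by linarith
    then obtain w where w: "w \<in> nb E A p" "dense 5 A (star E w (nb E A p))"
      using star_gain[OF finA sg d, of "nb E A p"] nbz unfolding A_def by (auto simp: nb_def)
    then have "KM 5 A (star E w (nb E A p))" using mader_5 finA sgraph_star[OF sg] by blast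
    then have "KM (Suc 5) (insert z A) (star E w (nb E A p))"
      by (rule KM_insert_dominating) (use zA sg in \<open>auto simp: star_def A_def nb_def sgraph_def\<close>)
    then have "KM 6 (insert z A) (star E w (nb E A p))" by simp
    then have "KM 6 (H - {p}) (star E w (Collect (E p)))"
      by (rule KM_mono) (use zA z Ezp in \<open>auto simp: star_def nb_def\<close>)
    moreover have "w \<in> H" "w \<noteq> p" "E w p"
      using w(1) zA Ezp sg by (auto simp: nb_def sgraph_def)
    ultimately show ?thesis using KM.contr[of w H p E 6] Ezp(3) by blast
  qed
qed

text \<open>A vertex of \<open>H - S\<close> of degree 5 or not dominating gives the minor inside
  \<open>H\<close>. Otherwise \<open>H - S\<close> dominates or is empty; if empty, a vertex
  \<open>v\<close> leaving a 5-clique minor behind becomes dominating by its star.\<close>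

lemma local_7: "local_config 7 H E S \<Longrightarrow> star_minor (7 - 1) H E S"
proof -
  assume c: "local_config 7 H E S"
  have fin: "finite H" and sg: "sgraph E" and S: "S \<subseteq> H" and H: "card H \<le> 9"
    and deg: "\<And>x. x \<in> H \<Longrightarrow> 5 \<le> card (nb E H x)"
    using c by (auto simp: local_config_def)
  have six: "6 \<le> card H" using local_degree_card[OF c] by simp
  show ?thesis
  proof (cases "\<exists>z\<in>H - S. card (nb E H z) = 5 \<or> nb E H z \<noteq> H - {z}")
    case True
    then obtain z where z: "z \<in> H - S" "card (nb E H z) = 5 \<or> nb E H z \<noteq> H - {z}" by blast
    then have "KM 6 H E"
      using KM6_of_low_vertex[OF fin sg H deg, of z] nb_nb_degree[OF c z(1)] by auto
    then show ?thesis by (simp add: star_minor_def)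
  next
    case dom: False
    show ?thesis
    proof (cases "S = H")
      case False
      then obtain z where "z \<in> H - S" using S by blast
      then show ?thesis
        using local_all_dominating[OF c, of z] dom mader_4[OF _ sg] by auto
    next
      case True
      show ?thesis
      proof (cases "card H = 6")
        case True
        have "5 * 6 \<le> arcs E H" using arcs_ge[OF fin deg] True by metis
        obtain v where v: "v \<in> H" using True by fastforce
        have "card (nb E H v) \<le> 5" using card_nb_le[OF sg fin v] True by simp
        then have "20 \<le> arcs E (H - {v})" using arcs_remove[OF sg fin v] \<open>5 * 6 \<le> arcs E H\<close> by simp
        then have "KM 5 (H - {v}) E"
          using True fin v sg by (intro mader_5) (auto simp: dense_def)
        then show ?thesis using KM_star_all[OF v, of 5 E] v \<open>S = H\<close> by (auto simp: star_minor_def)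
      next
        case False
        then obtain v where v: "v \<in> H" "KM 5 (H - {v}) E"
          using KM5_delete_vertex[OF fin sg _ H deg] six by fastforce
        then show ?thesis using KM_star_all[OF v] \<open>S = H\<close> by (auto simp: star_minor_def)
      qed
    qed
  qed
qed

section \<open>Assembling the theorem\<close>

lemma local_star_minor:
  assumes "3 \<le> r" "r \<le> 7" "local_config r H E S"
  shows "star_minor (r - 1) H E S"
proof -
  consider "r = 3" | "r = 4" | "r = 5" | "r = 6" | "r = 7" using assms by linarith
  then show ?thesis
    using assms(3) local_3 local_4 local_5 local_6 local_7 by cases blast+
qed

theorem mainTheorem1:
  fixes V :: "'a set" and E :: "'a set set" and r :: nat
  assumes "3 \<le> r" and "r \<le> 7"
    and "simple_graph V E"
    and "Kr_minor_free r V E"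
    and "E \<noteq> {}"
  shows "\<exists>u v. {u, v} \<in> E \<and> degree E u \<le> 2 * r - 5 \<and> triangles_on E u v \<le> r - 3"
proof (rule ccontr)
  assume contra: "\<not> ?thesis"
  define F where "F = (\<lambda>a b. {a, b} \<in> E)"
  \<comment> \<open>Isolated vertices are discarded so that \<open>pos\<close> holds.\<close>
  define W where "W = {a. \<exists>b. F a b}"
  have edge: "a \<in> V \<and> b \<in> V \<and> a \<noteq> b" if "{a, b} \<in> E" for a b
    using assms(3) that unfolding simple_graph_def by (metis doubleton_eq_iff)
  have sg: "sgraph F" unfolding sgraph_def F_def using edge by (metis insert_commute)
  have WV: "W \<subseteq> V" using edge by (auto simp: W_def F_def)
  then have fin: "finite W" using assms(3) finite_subset by (auto simp: simple_graph_def)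
  have nbW: "nb F W u = {v. {u, v} \<in> E}" for u
    using sg by (auto simp: nb_def W_def F_def sgraph_def)
  have free: "\<not> KM r W F"
  proof
    assume "KM r W F"
    then have "KM r V F" using WV by (rule KM_mono) auto
    then show False
      using KM_imp_minor[OF _ assms(3)] assms(4) by (auto simp: F_def Kr_minor_free_def)
  qed
  have nondense: "\<not> dense r X F" if "X \<subseteq> W" for X
    using KM_if_dense[OF assms(1,2) local_star_minor[OF assms(1,2)], of X F]
      KM_mono[of r X F W F] that free fin finite_subset sg by blast
  interpret locally_dense W F r
  proof
    fix X assume "X \<subset> W" "r - 2 \<le> card X"
    then show "arcs F X + (r - 1) * (r - 2) \<le> 2 * (r - 2) * card X"
      using nondense[of X] by (auto simp: dense_def)
  next
    fix u v assume uv: "u \<in> W" "v \<in> W" "F u v" "card (nb F W u) \<le> 2 * r - 5"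
    then have "\<not> triangles_on E u v \<le> r - 3"
      using contra unfolding degree_def nbW by (auto simp: F_def)
    then show "r - 2 \<le> card (nb F W u \<inter> nb F W v)"
      using assms(1) by (simp add: triangles_on_def nbW Int_def)
  next
    fix u assume "u \<in> W"
    then show "nb F W u \<noteq> {}" unfolding nbW by (auto simp: W_def F_def)
  qed (use assms local_star_minor fin sg free in auto)
  have "2 * r - 4 \<le> card (nb F W u)" if "u \<in> W" for u
    using no_low_vertex[of u] that unfolding low_def by simp
  then have many: "(2 * r - 4) * card W \<le> arcs F W" using arcs_ge[OF fin] by blast
  obtain u where u: "u \<in> W"
  proof -
    obtain e where "e \<in> E" using assms(5) by blast
    then obtain a b where "{a, b} \<in> E" using assms(3) unfolding simple_graph_def by metis
    then show ?thesis using that by (auto simp: W_def F_def)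
  qed
  \<comment> \<open>This supplies the size condition in \<open>dense\<close>; the degree sum over
    \<open>W\<close> then violates the bound already proved for all subsets of
    \<open>W\<close>.\<close>
  have "2 * r - 4 \<le> card W - 1"
    using no_low_vertex[of u] u card_nb_le[OF sg fin u] unfolding low_def by simp
  moreover have "(2 * r - 4) * card W = 2 * (r - 2) * card W" by (simp add: diff_mult_distrib2)
  moreover have "0 < (r - 1) * (r - 2)" using assms(1) by simp
  ultimately have "dense r W F" using many assms(1) unfolding dense_def by linarith
  then show False using nondense by blast
qed

end
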